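(* Let $\Delta$ be an additive subgroup of $\mathbb{C}$ and let $\mathcal{A}=\mathcal{A}_{\Delta,\{0\}}$ be the complex vector space with basis $\{x_\alpha\mid\alpha\in\Delta\}$, equipped with the commutative associative product $x_\alpha\cdot x_\beta=x_{\alpha+\beta}$. For $\xi\in\mathcal{A}$ define a bilinear operation $\diamond_\xi$ on $\mathcal{A}$ by $$x_\alpha\diamond_\xi x_\beta=\beta x_{\alpha+\beta}+\xi\cdot x_{\alpha+\beta}\qquad\text{for }\alpha,\beta\in\Delta.$$ Then the Novikov algebra structures $\circ$ on $\mathcal{A}$ whose commutator algebra is given by $$x_\alpha\circ x_\beta-x_\beta\circ x_\alpha=(\beta-\alpha)x_{\alpha+\beta}\qquad\text{for }\alpha,\beta\in\Delta$$ are exactly the operations $\diamond_\xi$, $\xi\in\mathcal{A}$.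
   Context: A Novikov algebra $(\mathcal{A},\circ)$ (over $\mathbb{C}$) is a vector space with a bilinear operation $\circ$ satisfying $(u\circ v)\circ w=(u\circ w)\circ v$ and $(u,v,w)=(v,u,w)$ for all $u,v,w\in\mathcal{A}$, where $(u,v,w)=(u\circ v)\circ w-u\circ(v\circ w)$. *)

theory Defs
  imports Complex_Main "HOL-Library.Poly_Mapping"
begin

section \<open>Novikov algebras\<close>

text \<open>
  The underlying vector space is a subspace \<open>A\<close> of an ambient complex vector space with scalar
  multiplication \<open>scale\<close>. The operation is a total function on the ambient type, but only its
  values on \<open>A\<close> are constrained.
\<close>

definition associator :: "('v \<Rightarrow> 'v \<Rightarrow> 'v) \<Rightarrow> 'v \<Rightarrow> 'v \<Rightarrow> 'v \<Rightarrow> 'v::ab_group_add" where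
  "associator op u v w = op (op u v) w - op u (op v w)"

definition bilinear_operation_on ::
    "(complex \<Rightarrow> 'v \<Rightarrow> 'v) \<Rightarrow> 'v set \<Rightarrow> ('v \<Rightarrow> 'v \<Rightarrow> 'v::ab_group_add) \<Rightarrow> bool" where
  "bilinear_operation_on scale A op \<longleftrightarrow>
     (\<forall>u\<in>A. \<forall>v\<in>A. op u v \<in> A) \<and>
     (\<forall>u\<in>A. \<forall>u'\<in>A. \<forall>v\<in>A. op (u + u') v = op u v + op u' v) \<and>
     (\<forall>u\<in>A. \<forall>v\<in>A. \<forall>v'\<in>A. op u (v + v') = op u v + op u v') \<and>
     (\<forall>c. \<forall>u\<in>A. \<forall>v\<in>A. op (scale c u) v = scale c (op u v)) \<and>
     (\<forall>c. \<forall>u\<in>A. \<forall>v\<in>A. op u (scale c v) = scale c (op u v))"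

locale novikov_algebra = vector_space scale
  for scale :: "complex \<Rightarrow> 'v::ab_group_add \<Rightarrow> 'v" +
  fixes A :: "'v set"
    and op :: "'v \<Rightarrow> 'v \<Rightarrow> 'v"
  assumes subspace_carrier: "subspace A"
    and bilinear: "bilinear_operation_on scale A op"
    and right_commute: "\<lbrakk>u \<in> A; v \<in> A; w \<in> A\<rbrakk> \<Longrightarrow> op (op u v) w = op (op u w) v"
    and left_symmetric:
      "\<lbrakk>u \<in> A; v \<in> A; w \<in> A\<rbrakk> \<Longrightarrow> associator op u v w = associator op v u w"


section \<open>The group algebra of an additive subgroup of the complex numbers\<close>

definition additive_subgroup :: "complex set \<Rightarrow> bool" where
  "additive_subgroup \<Delta> \<longleftrightarrow>
     0 \<in> \<Delta> \<and> (\<forall>\<alpha>\<in>\<Delta>. \<forall>\<beta>\<in>\<Delta>. \<alpha> + \<beta> \<in> \<Delta>) \<and> (\<forall>\<alpha>\<in>\<Delta>. - \<alpha> \<in> \<Delta>)"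

text \<open>
  The ambient space is the group algebra of the whole additive group of complex numbers:
  finitely supported functions, with the convolution product of the library as
  multiplication. The algebra for \<open>\<Delta>\<close> consists of the functions supported in \<open>\<Delta>\<close>; that the
  \<open>basis_x \<alpha>\<close> for \<open>\<alpha> \<in> \<Delta>\<close> form a basis is proved below.
\<close>

type_synonym cpoly = "complex \<Rightarrow>\<^sub>0 complex"

definition smult :: "complex \<Rightarrow> cpoly \<Rightarrow> cpoly" where
  "smult c u = Poly_Mapping.map ((*) c) u"

definition basis_x :: "complex \<Rightarrow> cpoly" where
  "basis_x \<alpha> = Poly_Mapping.single \<alpha> 1"

definition group_algebra :: "complex set \<Rightarrow> cpoly set" where
  "group_algebra \<Delta> = {u. Poly_Mapping.keys u \<subseteq> \<Delta>}"

text \<open>The bilinear extension of its values on basis elements, see \<open>diamond_basis\<close>.\<close>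

definition diamond :: "cpoly \<Rightarrow> cpoly \<Rightarrow> cpoly \<Rightarrow> cpoly" where
  "diamond \<xi> u v =
     (\<Sum>\<alpha>\<in>Poly_Mapping.keys u. \<Sum>\<beta>\<in>Poly_Mapping.keys v.
        smult (Poly_Mapping.lookup u \<alpha> * Poly_Mapping.lookup v \<beta>)
          (smult \<beta> (basis_x (\<alpha> + \<beta>)) + \<xi> * basis_x (\<alpha> + \<beta>)))"

lemma smult_eq_mult: "smult c u = Poly_Mapping.single 0 c * u"
  by (simp add: smult_def mult_map_scale_conv_mult)

lemma lookup_smult: "Poly_Mapping.lookup (smult c u) k = c * Poly_Mapping.lookup u k"
  by (simp add: smult_def map.rep_eq when_def)

lemma vector_space_smult: "vector_space smult"
  by (unfold_locales) (auto intro!: poly_mapping_eqI simp: lookup_smult lookup_add algebra_simps)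

lemma x_mult: "basis_x \<alpha> * basis_x \<beta> = basis_x (\<alpha> + \<beta>)"
  by (simp add: basis_x_def mult_single)

lemma inj_x: "inj basis_x"
  by (auto simp: inj_def basis_x_def poly_mapping_eq_iff lookup_single fun_eq_iff when_def)

lemma diamond_basis:
  "diamond \<xi> (basis_x \<alpha>) (basis_x \<beta>) = smult \<beta> (basis_x (\<alpha> + \<beta>)) + \<xi> * basis_x (\<alpha> + \<beta>)"
  using vector_space_smult by (simp add: diamond_def basis_x_def vector_space_def)

lemma subspace_group_algebra: "module.subspace smult (group_algebra \<Delta>)"
proof -
  interpret vector_space smult by (rule vector_space_smult)
  show ?thesis
    by (auto simp: subspace_def group_algebra_def subset_iff in_keys_iff lookup_add lookup_smult)
      (metis add.right_neutral)
qed

lemma expand_x: "u = (\<Sum>\<alpha>\<in>Poly_Mapping.keys u. smult (Poly_Mapping.lookup u \<alpha>) (basis_x \<alpha>))"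
  by (rule poly_mapping_eqI)
    (simp add: lookup_sum lookup_smult basis_x_def lookup_single when_def if_distrib[of "(*) _"]
       in_keys_iff cong: if_cong)

lemma span_x: "module.span smult (basis_x ` \<Delta>) = group_algebra \<Delta>"
proof -
  interpret vector_space smult by (rule vector_space_smult)
  show ?thesis
  proof
    show "span (basis_x ` \<Delta>) \<subseteq> group_algebra \<Delta>"
      by (rule span_minimal[OF _ subspace_group_algebra]) (auto simp: group_algebra_def basis_x_def)
    show "group_algebra \<Delta> \<subseteq> span (basis_x ` \<Delta>)"
    proof
      fix u assume "u \<in> group_algebra \<Delta>"
      then have "(\<Sum>\<alpha>\<in>Poly_Mapping.keys u. smult (Poly_Mapping.lookup u \<alpha>) (basis_x \<alpha>)) \<in> span (basis_x ` \<Delta>)"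
        by (intro span_sum span_scale span_base) (auto simp: group_algebra_def)
      then show "u \<in> span (basis_x ` \<Delta>)"
        using expand_x[of u] by simp
    qed
  qed
qed

lemma independent_x: "\<not> module.dependent smult (basis_x ` \<Delta>)"
proof -
  interpret vector_space smult by (rule vector_space_smult)
  have "c v = 0"
    if fin: "finite t" and t: "t \<subseteq> basis_x ` \<Delta>" and sum0: "(\<Sum>w\<in>t. smult (c w) w) = 0" and v: "v \<in> t"
    for t c v
  proof -
    from t v obtain \<alpha> where \<alpha>: "v = basis_x \<alpha>" by auto
    have "0 = (\<Sum>w\<in>t. c w * Poly_Mapping.lookup w \<alpha>)"
      using arg_cong[OF sum0, of "\<lambda>u. Poly_Mapping.lookup u \<alpha>"]
      by (simp add: lookup_sum lookup_smult)
    also have "\<dots> = (\<Sum>w\<in>t. if w = v then c v else 0)"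
    proof (rule sum.cong)
      fix w assume "w \<in> t"
      with t obtain \<beta> where "w = basis_x \<beta>" by auto
      then show "c w * Poly_Mapping.lookup w \<alpha> = (if w = v then c v else 0)"
        using \<alpha> inj_x by (auto simp: basis_x_def lookup_single when_def inj_def)
    qed simp
    also have "\<dots> = c v" using fin v by simp
    finally show ?thesis by simp
  qed
  then show ?thesis unfolding independent_explicit_module by blast
qed

end

theory Submission
  imports Defs
begin

text \<open>
  Write \<open>[u, v]\<close> for the commutator. Left symmetry and right commutativity together give an
  identity that is linear in \<open>\<circ>\<close>:
  \<open>[u, v] \<circ> w = [u, v \<circ> w] - [v, u \<circ> w] + [v, w] \<circ> u - [u, w] \<circ> v\<close>.
  Hence it can be read off degree by degree: if \<open>\<phi> \<alpha> \<beta>\<close> is the coefficient of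
  \<open>x\<^bsub>\<alpha>+\<beta>+\<theta>\<^esub>\<close> in \<open>x\<^bsub>\<alpha>\<^esub> \<circ> x\<^bsub>\<beta>\<^esub> - \<beta> x\<^bsub>\<alpha>+\<beta>\<^esub>\<close>, then \<open>\<phi>\<close> is symmetric and satisfies one linear
  functional equation, whose only symmetric solutions are the constants. So
  \<open>x\<^bsub>\<alpha>\<^esub> \<circ> x\<^bsub>\<beta>\<^esub> - \<beta> x\<^bsub>\<alpha>+\<beta>\<^esub> = \<xi> x\<^bsub>\<alpha>+\<beta>\<^esub>\<close> with \<open>\<xi> = x\<^bsub>0\<^esub> \<circ> x\<^bsub>0\<^esub>\<close>. Conversely
  \<open>u \<diamondop>\<^bsub>\<xi>\<^esub> v = u D v + \<xi> u v\<close> for the derivation \<open>D x\<^bsub>\<alpha>\<^esub> = \<alpha> x\<^bsub>\<alpha>\<^esub>\<close>.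
\<close>

section \<open>Products and coefficients in the group algebra\<close>

interpretation cpoly: vector_space smult
  by (rule vector_space_smult)

lemma smult_mult_left: "smult c u * v = smult c (u * v)"
  by (simp add: smult_eq_mult mult.assoc)

lemma smult_mult_right: "u * smult c v = smult c (u * v)"
  by (simp add: smult_eq_mult mult.left_commute)

lemma group_algebra_UNIV: "group_algebra UNIV = UNIV"
  by (simp add: group_algebra_def)

lemma basis_x_in_group_algebra: "\<alpha> \<in> \<Delta> \<Longrightarrow> basis_x \<alpha> \<in> group_algebra \<Delta>"
  by (simp add: group_algebra_def basis_x_def)

lemma mult_in_group_algebra:
  assumes "additive_subgroup \<Delta>" "u \<in> group_algebra \<Delta>" "v \<in> group_algebra \<Delta>"
  shows "u * v \<in> group_algebra \<Delta>"
  using assms keys_mult[of u v] unfolding group_algebra_def additive_subgroup_def by blast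

lemma lookup_basis_x: "Poly_Mapping.lookup (basis_x \<alpha>) k = (if k = \<alpha> then 1 else 0)"
  by (simp add: basis_x_def lookup_single when_def)

text \<open>Multiplication by \<open>basis_x \<alpha>\<close> only shifts degrees, so coefficients
  of \<xi> can be read off from its multiples.\<close>

lemma lookup_mult_basis_x:
  "Poly_Mapping.lookup (u * basis_x \<alpha>) (\<alpha> + k) = Poly_Mapping.lookup u k"
proof -
  have "u \<in> cpoly.span (range basis_x)"
    by (simp add: span_x group_algebra_UNIV)
  then show ?thesis
  proof (induction rule: cpoly.span_induct_alt)
    case (step c x y)
    then obtain \<beta> where "x = basis_x \<beta>" by blast
    with step show ?case
      by (simp add: distrib_right lookup_add smult_mult_left lookup_smult x_mult)
        (auto simp: lookup_basis_x add.commute)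
  qed simp
qed


section \<open>The degree derivation\<close>

text \<open>The derivation \<open>D\<close> of the grading: \<open>mapp\<close> passes each key,
  that is the degree, as the factor.\<close>

definition degree_der :: "cpoly \<Rightarrow> cpoly" where
  "degree_der u = Poly_Mapping.mapp (*) u"

lemma lookup_degree_der: "Poly_Mapping.lookup (degree_der u) k = k * Poly_Mapping.lookup u k"
  by (simp add: degree_der_def lookup_mapp when_def in_keys_iff)

lemma degree_der_in_group_algebra: "u \<in> group_algebra \<Delta> \<Longrightarrow> degree_der u \<in> group_algebra \<Delta>"
  by (auto simp: group_algebra_def in_keys_iff lookup_degree_der)

lemma degree_der_add: "degree_der (u + v) = degree_der u + degree_der v"
  by (rule poly_mapping_eqI) (simp add: lookup_degree_der lookup_add distrib_left)

lemma degree_der_smult: "degree_der (smult c u) = smult c (degree_der u)"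
  by (rule poly_mapping_eqI) (simp add: lookup_degree_der lookup_smult)

lemma degree_der_0: "degree_der 0 = 0"
  by (rule poly_mapping_eqI) (simp add: lookup_degree_der)

lemma degree_der_basis_x: "degree_der (basis_x \<alpha>) = smult \<alpha> (basis_x \<alpha>)"
  by (rule poly_mapping_eqI)
    (simp add: lookup_degree_der lookup_smult lookup_basis_x)

lemma degree_der_sum: "degree_der (sum f S) = (\<Sum>i\<in>S. degree_der (f i))"
  by (induction S rule: infinite_finite_induct) (simp_all add: degree_der_0 degree_der_add)

text \<open>Both sides are bilinear, so two basis elements suffice; there the Leibniz rule says that
  degrees add.\<close>

lemma degree_der_mult: "degree_der (u * v) = degree_der u * v + u * degree_der v"
proof -
  have span: "w \<in> cpoly.span (range basis_x)" for w
    by (simp add: span_x group_algebra_UNIV)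
  have basis: "degree_der (basis_x \<alpha> * v) = degree_der (basis_x \<alpha>) * v + basis_x \<alpha> * degree_der v"
    for \<alpha>
    using span[of v]
  proof (induction rule: cpoly.span_induct_alt)
    case (step c x y)
    then obtain \<beta> where x: "x = basis_x \<beta>" by blast
    show ?case
      unfolding x distrib_left degree_der_add step.IH
      by (simp add: smult_mult_right smult_mult_left degree_der_smult x_mult degree_der_basis_x
          cpoly.scale_left_distrib algebra_simps)
  qed (simp add: degree_der_0)
  from span[of u] show ?thesis
  proof (induction rule: cpoly.span_induct_alt)
    case (step c x y)
    then obtain \<alpha> where x: "x = basis_x \<alpha>" by blast
    show ?case
      unfolding x distrib_right degree_der_add step.IH smult_mult_left degree_der_smult basis
      by (simp add: cpoly.scale_right_distrib algebra_simps)
  qed (simp add: degree_der_0)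
qed

text \<open>Replaces the double sum by an expression in a commutative ring with a derivation, where
  the Novikov axioms become ring identities.\<close>

lemma diamond_eq_degree_der: "diamond \<xi> u v = u * degree_der v + \<xi> * (u * v)"
proof -
  let ?u = "Poly_Mapping.lookup u" and ?v = "Poly_Mapping.lookup v"
  let ?E = "\<lambda>w. \<Sum>\<alpha>\<in>Poly_Mapping.keys w. smult (Poly_Mapping.lookup w \<alpha>) (basis_x \<alpha>)"
  have "?E u * ?E v = (\<Sum>\<alpha>\<in>Poly_Mapping.keys u. \<Sum>\<beta>\<in>Poly_Mapping.keys v.
      smult (?u \<alpha> * ?v \<beta>) (basis_x (\<alpha> + \<beta>)))"
    by (simp add: sum_product smult_mult_left smult_mult_right x_mult mult.commute)
  moreover have "?E u * degree_der (?E v) = (\<Sum>\<alpha>\<in>Poly_Mapping.keys u. \<Sum>\<beta>\<in>Poly_Mapping.keys v.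
      smult (?u \<alpha> * ?v \<beta>) (smult \<beta> (basis_x (\<alpha> + \<beta>))))"
    by (simp add: degree_der_sum degree_der_smult degree_der_basis_x sum_product smult_mult_left
        smult_mult_right x_mult mult.commute mult.left_commute)
  ultimately have "?E u * degree_der (?E v) + \<xi> * (?E u * ?E v) = diamond \<xi> u v"
    by (simp add: diamond_def sum_distrib_left smult_mult_right cpoly.scale_right_distrib
        sum.distrib)
  then show ?thesis
    by (simp flip: expand_x)
qed

text \<open>Put \<open>D = degree_der\<close> and \<open>E w = D w + \<xi> * w\<close>, so the
  product of \<open>u\<close> and \<open>v\<close> is \<open>u * E v\<close>. The product of
  \<open>u\<close>, \<open>v\<close>, \<open>w\<close> bracketed to the left is
  \<open>u * E v * E w\<close>, symmetric in \<open>v\<close> and \<open>w\<close>; the associator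
  is \<open>- u * v * D (E w)\<close>, symmetric in \<open>u\<close> and \<open>v\<close>.\<close>

lemma novikov_algebra_diamond:
  assumes \<Delta>: "additive_subgroup \<Delta>" and \<xi>: "\<xi> \<in> group_algebra \<Delta>"
    and op: "\<And>u v. \<lbrakk>u \<in> group_algebra \<Delta>; v \<in> group_algebra \<Delta>\<rbrakk> \<Longrightarrow> op u v = diamond \<xi> u v"
  shows "novikov_algebra smult (group_algebra \<Delta>) op"
proof -
  note sub = subspace_group_algebra[of \<Delta>]
  have closed: "diamond \<xi> u v \<in> group_algebra \<Delta>"
    if "u \<in> group_algebra \<Delta>" "v \<in> group_algebra \<Delta>" for u v
    unfolding diamond_eq_degree_der using that \<Delta> \<xi>
    by (intro cpoly.subspace_add[OF sub] mult_in_group_algebra degree_der_in_group_algebra)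
  show ?thesis
  proof
    show "cpoly.subspace (group_algebra \<Delta>)" by (rule sub)
    show "bilinear_operation_on smult (group_algebra \<Delta>) op"
      unfolding bilinear_operation_on_def
      by (auto simp: op closed cpoly.subspace_add[OF sub] cpoly.subspace_scale[OF sub])
        (auto simp: diamond_eq_degree_der degree_der_add degree_der_smult smult_mult_left
          smult_mult_right cpoly.scale_right_distrib algebra_simps)
  next
    fix u v w
    assume uvw: "u \<in> group_algebra \<Delta>" "v \<in> group_algebra \<Delta>" "w \<in> group_algebra \<Delta>"
    show "op (op u v) w = op (op u w) v"
      by (simp add: op closed uvw) (simp add: diamond_eq_degree_der algebra_simps)
    show "associator op u v w = associator op v u w"
      by (simp add: op closed uvw associator_def)
        (simp add: diamond_eq_degree_der degree_der_mult degree_der_add algebra_simps)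
  qed
qed


section \<open>The functional equation\<close>

text \<open>First \<open>\<phi> 0\<close> is shown to be constant. If \<theta> is nonzero, it
  determines \<phi>; if \<theta> = 0, further instances of the equation are needed.\<close>

lemma symmetric_cocycle_constant:
  fixes \<phi> :: "complex \<Rightarrow> complex \<Rightarrow> complex"
  assumes \<Delta>: "additive_subgroup \<Delta>"
    and sym: "\<And>\<alpha> \<beta>. \<lbrakk>\<alpha> \<in> \<Delta>; \<beta> \<in> \<Delta>\<rbrakk> \<Longrightarrow> \<phi> \<alpha> \<beta> = \<phi> \<beta> \<alpha>"
    and eq: "\<And>\<alpha> \<beta> \<gamma>. \<lbrakk>\<alpha> \<in> \<Delta>; \<beta> \<in> \<Delta>; \<gamma> \<in> \<Delta>\<rbrakk> \<Longrightarrow>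
      (\<beta> - \<alpha>) * \<phi> (\<alpha> + \<beta>) \<gamma> =
        (\<beta> + \<gamma> + \<theta> - \<alpha>) * \<phi> \<beta> \<gamma> - (\<alpha> + \<gamma> + \<theta> - \<beta>) * \<phi> \<alpha> \<gamma>
        + (\<gamma> - \<beta>) * \<phi> (\<beta> + \<gamma>) \<alpha> - (\<gamma> - \<alpha>) * \<phi> (\<alpha> + \<gamma>) \<beta>"
    and \<alpha>: "\<alpha> \<in> \<Delta>" and \<beta>: "\<beta> \<in> \<Delta>"
  shows "\<phi> \<alpha> \<beta> = \<phi> 0 0"
proof -
  have zero: "0 \<in> \<Delta>" and add: "\<And>\<alpha> \<beta>. \<lbrakk>\<alpha> \<in> \<Delta>; \<beta> \<in> \<Delta>\<rbrakk> \<Longrightarrow> \<alpha> + \<beta> \<in> \<Delta>"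
    and uminus: "\<And>\<alpha>. \<alpha> \<in> \<Delta> \<Longrightarrow> - \<alpha> \<in> \<Delta>"
    using \<Delta> by (auto simp: additive_subgroup_def)
  define g where "g = \<phi> 0"
  \<comment> \<open>The equation at \<alpha> = 0: by symmetry its three terms in
    \<open>\<phi> \<beta> \<gamma>\<close> combine to \<theta> times that value.\<close>
  have g: "\<theta> * \<phi> \<beta> \<gamma> = (\<gamma> + \<theta> - \<beta>) * g \<gamma> + (\<beta> - \<gamma>) * g (\<beta> + \<gamma>)"
    if "\<beta> \<in> \<Delta>" "\<gamma> \<in> \<Delta>" for \<beta> \<gamma>
    using eq[OF zero that] sym[OF zero add[OF that]] sym[OF that]
    by (simp add: g_def algebra_simps)
  \<comment> \<open>The left side of the previous relation is symmetric; equating its right side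
    with the swapped one leaves a condition on \<open>g\<close> alone.\<close>
  have g2: "2 * (\<beta> - \<gamma>) * g (\<beta> + \<gamma>) = (\<theta> + \<beta> - \<gamma>) * g \<beta> - (\<theta> + \<gamma> - \<beta>) * g \<gamma>"
    if "\<beta> \<in> \<Delta>" "\<gamma> \<in> \<Delta>" for \<beta> \<gamma>
    using g[OF that] g[OF that(2,1)] sym[OF that]
    by (simp add: algebra_simps)
  \<comment> \<open>Taking \<gamma> = 0 settles every degree except \<theta>.\<close>
  have g_generic: "g \<beta> = g 0" if "\<beta> \<in> \<Delta>" "\<beta> \<noteq> \<theta>" for \<beta>
  proof -
    have "(\<beta> - \<theta>) * (g \<beta> - g 0) = 0"
      using g2[OF that(1) zero] by (simp add: algebra_simps)
    with that show ?thesis by simp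
  qed
  have g_const: "g \<beta> = g 0" if "\<beta> \<in> \<Delta>" for \<beta>
  proof (cases "\<beta> = \<theta> \<and> \<theta> \<noteq> 0")
    case True
    \<comment> \<open>The exceptional degree is split as \<theta> = 2\<theta> + (-\<theta>); both
      summands differ from \<theta>, so the generic case covers them.\<close>
    have "\<theta> \<in> \<Delta>" using True that by simp
    then have 2: "\<theta> + \<theta> \<in> \<Delta>" and m: "- \<theta> \<in> \<Delta>"
      by (blast intro: add uminus)+
    have "6 * \<theta> * (g \<theta> - g 0) = 0"
      using g2[OF 2 m] g_generic[OF 2] g_generic[OF m] True by (simp add: algebra_simps)
    with True show ?thesis by simp
  qed (use g_generic that in auto)
  show ?thesis
  proof (cases "\<theta> = 0")
    case False
    have "\<theta> * (\<phi> \<alpha> \<beta> - g 0) = 0"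
      using g[OF \<alpha> \<beta>] g_const[OF \<alpha>] g_const[OF \<beta>] g_const[OF add[OF \<alpha> \<beta>]]
      by (simp add: algebra_simps)
    with False show ?thesis by (simp add: g_def)
  next
    case True
    \<comment> \<open>For \<theta> = 0 the left side of the relation \<open>g\<close> vanishes. The
      equation with third argument 0 replaces it, up to the factor \<alpha> - \<beta>.\<close>
    have off: "\<phi> \<alpha> \<beta> = g 0" if "\<alpha> \<in> \<Delta>" "\<beta> \<in> \<Delta>" "\<alpha> \<noteq> \<beta>" for \<alpha> \<beta>
    proof -
      have "\<phi> \<delta> 0 = g 0" if "\<delta> \<in> \<Delta>" for \<delta>
        using g_const[OF that] sym[OF that zero] by (simp add: g_def)
      then have "(\<alpha> - \<beta>) * (\<phi> \<alpha> \<beta> - g 0) = 0"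
        using eq[OF that(1,2) zero] sym[OF that(1,2)] that add True
        by (simp add: algebra_simps)
      with that show ?thesis by simp
    qed
    \<comment> \<open>In \<open>eq\<close> at 2\<gamma>, -\<gamma>, \<gamma> the first two arguments
      add up to \<gamma>, so the diagonal value appears on the left, while all values on the right
      are off the diagonal.\<close>
    have "\<phi> \<gamma> \<gamma> = g 0" if "\<gamma> \<in> \<Delta>" "\<gamma> \<noteq> 0" for \<gamma>
    proof -
      have 2: "\<gamma> + \<gamma> \<in> \<Delta>" and 3: "\<gamma> + \<gamma> + \<gamma> \<in> \<Delta>" and m: "- \<gamma> \<in> \<Delta>"
        using that(1) by (blast intro: add uminus)+
      have ne: "- \<gamma> \<noteq> \<gamma>" "\<gamma> + \<gamma> \<noteq> \<gamma>" "0 \<noteq> \<gamma> + \<gamma>" "\<gamma> + \<gamma> + \<gamma> \<noteq> - \<gamma>"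
        using that by (auto simp: eq_neg_iff_add_eq_0 neg_eq_iff_add_eq_0 simp flip: mult_2)
      have "3 * \<gamma> * (\<phi> \<gamma> \<gamma> - g 0) = 0"
        using eq[OF 2 m that(1)] off[OF m that(1) ne(1)] off[OF 2 that(1) ne(2)]
          off[OF zero 2 ne(3)] off[OF 3 m ne(4)] True
        by (auto simp: algebra_simps)
      with that show ?thesis by simp
    qed
    then show ?thesis
      using off[OF \<alpha> \<beta>] \<alpha> by (cases "\<alpha> = \<beta>"; cases "\<alpha> = 0") (auto simp: g_def)
  qed
qed


section \<open>Novikov algebras\<close>

text \<open>Right commutativity, in the form \<open>op (op w u) v = op (op w v) u\<close>, collapses
  the right side to \<open>op u (op v w) - op v (op u w)\<close>; what remains is left symmetry. The
  expanded form is useful because every nested product sits inside a commutator or has one as a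
  factor.\<close>

lemma (in novikov_algebra) commutator_identity:
  assumes "u \<in> A" "v \<in> A" "w \<in> A"
  shows "op (op u v - op v u) w =
    (op u (op v w) - op (op v w) u) - (op v (op u w) - op (op u w) v)
    + op (op v w - op w v) u - op (op u w - op w u) v"
proof -
  have closed: "op a b \<in> A" if "a \<in> A" "b \<in> A" for a b
    using bilinear that by (auto simp: bilinear_operation_on_def)
  have diff: "op (a - b) c = op a c - op b c" if "a \<in> A" "b \<in> A" "c \<in> A" for a b c
  proof -
    have "op ((a - b) + b) c = op (a - b) c + op b c"
      using bilinear that subspace_diff[OF subspace_carrier]
      unfolding bilinear_operation_on_def by blast
    then show ?thesis by simp
  qed
  show ?thesis
    using left_symmetric[OF assms] right_commute[OF assms(3,1,2)]
    by (simp add: diff closed assms associator_def algebra_simps)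
qed

section \<open>Bilinear extension and coefficients of commutators\<close>

lemma bilinear_operations_eqI:
  assumes "bilinear_operation_on smult (group_algebra \<Delta>) f"
    and "bilinear_operation_on smult (group_algebra \<Delta>) g"
    and basis: "\<And>\<alpha> \<beta>. \<lbrakk>\<alpha> \<in> \<Delta>; \<beta> \<in> \<Delta>\<rbrakk> \<Longrightarrow> f (basis_x \<alpha>) (basis_x \<beta>) = g (basis_x \<alpha>) (basis_x \<beta>)"
    and u: "u \<in> group_algebra \<Delta>" and v: "v \<in> group_algebra \<Delta>"
  shows "f u v = g u v"
proof -
  note sub = subspace_group_algebra[of \<Delta>]
  let ?B = "group_algebra \<Delta>"
  have add_left: "h (a + b) c = h a c + h b c" and add_right: "h c (a + b) = h c a + h c b"
    and scale_left: "h (smult k a) c = smult k (h a c)"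
    and scale_right: "h c (smult k a) = smult k (h c a)"
    if "h \<in> {f, g}" "a \<in> ?B" "b \<in> ?B" "c \<in> ?B" for h a b c k
    using assms(1,2) that by (auto simp: bilinear_operation_on_def)
  have zero_left: "h 0 c = 0" and zero_right: "h c 0 = 0" if "h \<in> {f, g}" "c \<in> ?B" for h c
    using scale_left[OF that(1,2,2,2), of 0] scale_right[OF that(1,2,2,2), of 0] by auto
  have basis_left: "f (basis_x \<alpha>) v = g (basis_x \<alpha>) v" if \<alpha>: "\<alpha> \<in> \<Delta>" for \<alpha>
  proof -
    have "v \<in> cpoly.span (basis_x ` \<Delta>)" using v by (simp add: span_x)
    \<comment> \<open>Membership is part of the induction claim because the bilinearity laws hold
      only on the carrier.\<close>
    then have "v \<in> ?B \<and> f (basis_x \<alpha>) v = g (basis_x \<alpha>) v"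
    proof (induction rule: cpoly.span_induct_alt)
      case base
      show ?case
        by (simp add: zero_right basis_x_in_group_algebra \<alpha> cpoly.subspace_0[OF sub])
    next
      case (step c x y)
      then have "x \<in> ?B" "f (basis_x \<alpha>) x = g (basis_x \<alpha>) x"
        using basis \<alpha> by (auto intro: basis_x_in_group_algebra)
      with step show ?case
        by (simp add: add_right scale_right basis_x_in_group_algebra \<alpha>
            cpoly.subspace_add[OF sub] cpoly.subspace_scale[OF sub])
    qed
    then show ?thesis ..
  qed
  have "u \<in> cpoly.span (basis_x ` \<Delta>)" using u by (simp add: span_x)
  then have "u \<in> ?B \<and> f u v = g u v"
  proof (induction rule: cpoly.span_induct_alt)
    case base
    show ?case by (simp add: zero_left v cpoly.subspace_0[OF sub])
  next
    case (step c x y)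
    then have "x \<in> ?B" "f x v = g x v"
      using basis_left by (auto intro: basis_x_in_group_algebra)
    with step show ?case
      by (simp add: add_left scale_left v
          cpoly.subspace_add[OF sub] cpoly.subspace_scale[OF sub])
  qed
  then show ?thesis ..
qed

text \<open>By bilinearity the commutator is the Witt-type bracket \<open>v * D w - D v * w\<close>
  on the whole algebra. This allows \<open>u\<close> to be a product such as
  \<open>op (basis_x \<beta>) (basis_x \<gamma>)\<close>, whose support is not yet known.\<close>

lemma lookup_commutator:
  assumes \<Delta>: "additive_subgroup \<Delta>"
    and op: "bilinear_operation_on smult (group_algebra \<Delta>) op"
    and comm: "\<And>\<alpha> \<beta>. \<lbrakk>\<alpha> \<in> \<Delta>; \<beta> \<in> \<Delta>\<rbrakk> \<Longrightarrow>
      op (basis_x \<alpha>) (basis_x \<beta>) - op (basis_x \<beta>) (basis_x \<alpha>) = smult (\<beta> - \<alpha>) (basis_x (\<alpha> + \<beta>))"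
    and \<alpha>: "\<alpha> \<in> \<Delta>" and u: "u \<in> group_algebra \<Delta>"
  shows "Poly_Mapping.lookup (op (basis_x \<alpha>) u - op u (basis_x \<alpha>)) (\<alpha> + k) =
    (k - \<alpha>) * Poly_Mapping.lookup u k"
proof -
  let ?B = "group_algebra \<Delta>"
  define f where "f v w = op v w - op w v" for v w
  define g where "g v w = v * degree_der w - degree_der v * w" for v w
  note sub = subspace_group_algebra[of \<Delta>]
  have "bilinear_operation_on smult ?B f"
    using op unfolding bilinear_operation_on_def f_def
    by (simp add: cpoly.subspace_diff[OF sub] cpoly.scale_right_diff_distrib)
  moreover have "bilinear_operation_on smult ?B g"
    unfolding bilinear_operation_on_def g_def
    by (simp add: cpoly.subspace_diff[OF sub] mult_in_group_algebra[OF \<Delta>]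
        degree_der_in_group_algebra degree_der_add degree_der_smult smult_mult_left
        smult_mult_right cpoly.scale_right_diff_distrib) (simp add: algebra_simps)
  moreover have "f (basis_x \<alpha>) (basis_x \<beta>) = g (basis_x \<alpha>) (basis_x \<beta>)"
    if "\<alpha> \<in> \<Delta>" "\<beta> \<in> \<Delta>" for \<alpha> \<beta>
    using comm[OF that] by (simp add: f_def g_def degree_der_basis_x smult_mult_left
        smult_mult_right x_mult cpoly.scale_left_diff_distrib)
  ultimately have "f (basis_x \<alpha>) u = g (basis_x \<alpha>) u"
    using basis_x_in_group_algebra[OF \<alpha>] u by (rule bilinear_operations_eqI)
  then have bracket: "op (basis_x \<alpha>) u - op u (basis_x \<alpha>) =
      degree_der u * basis_x \<alpha> - smult \<alpha> (u * basis_x \<alpha>)"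
    by (simp add: f_def g_def degree_der_basis_x smult_mult_right mult.commute)
  show ?thesis
    unfolding bracket
    by (simp add: lookup_minus lookup_smult lookup_mult_basis_x lookup_degree_der left_diff_distrib)
qed

theorem theorem6p2:
  fixes \<Delta> :: "complex set"
    and op :: "cpoly \<Rightarrow> cpoly \<Rightarrow> cpoly"
  assumes "additive_subgroup \<Delta>"
  shows "(novikov_algebra smult (group_algebra \<Delta>) op \<and>
          (\<forall>\<alpha>\<in>\<Delta>. \<forall>\<beta>\<in>\<Delta>. op (basis_x \<alpha>) (basis_x \<beta>) - op (basis_x \<beta>) (basis_x \<alpha>) = smult (\<beta> - \<alpha>) (basis_x (\<alpha> + \<beta>))))
         \<longleftrightarrow>
         (\<exists>\<xi>\<in>group_algebra \<Delta>. \<forall>u\<in>group_algebra \<Delta>. \<forall>v\<in>group_algebra \<Delta>. op u v = diamond \<xi> u v)"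
    (is "?novikov \<and> ?comm \<longleftrightarrow> ?diamond")
proof
  assume ?diamond
  then obtain \<xi> where \<xi>: "\<xi> \<in> group_algebra \<Delta>"
    and op: "\<And>u v. \<lbrakk>u \<in> group_algebra \<Delta>; v \<in> group_algebra \<Delta>\<rbrakk> \<Longrightarrow> op u v = diamond \<xi> u v"
    by blast
  from novikov_algebra_diamond[OF assms \<xi> op] have ?novikov .
  \<comment> \<open>The \<xi>-terms are symmetric in \<alpha> and \<beta> and cancel.\<close>
  moreover have ?comm
    by (simp add: op basis_x_in_group_algebra diamond_basis add.commute
        cpoly.scale_left_diff_distrib)
  ultimately show "?novikov \<and> ?comm" ..
next
  assume asm: "?novikov \<and> ?comm"
  then interpret novikov_algebra smult "group_algebra \<Delta>" op by simp
  have comm: "op (basis_x \<alpha>) (basis_x \<beta>) - op (basis_x \<beta>) (basis_x \<alpha>) =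
      smult (\<beta> - \<alpha>) (basis_x (\<alpha> + \<beta>))" if "\<alpha> \<in> \<Delta>" "\<beta> \<in> \<Delta>" for \<alpha> \<beta>
    using asm that by blast
  have zero: "0 \<in> \<Delta>" and add: "\<And>\<alpha> \<beta>. \<lbrakk>\<alpha> \<in> \<Delta>; \<beta> \<in> \<Delta>\<rbrakk> \<Longrightarrow> \<alpha> + \<beta> \<in> \<Delta>"
    using assms by (auto simp: additive_subgroup_def)
  note x_in = basis_x_in_group_algebra[of _ \<Delta>]
  have closed: "op u v \<in> group_algebra \<Delta>"
    if "u \<in> group_algebra \<Delta>" "v \<in> group_algebra \<Delta>" for u v
    using bilinear that by (auto simp: bilinear_operation_on_def)
  have scale_left: "op (smult c u) v = smult c (op u v)"
    if "u \<in> group_algebra \<Delta>" "v \<in> group_algebra \<Delta>" for c u v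
    using bilinear that by (auto simp: bilinear_operation_on_def)
  \<comment> \<open>Forced, since
    \<open>diamond \<xi> (basis_x 0) (basis_x 0) = \<xi>\<close>.\<close>
  define \<xi> where "\<xi> = op (basis_x 0) (basis_x 0)"
  have \<xi>: "\<xi> \<in> group_algebra \<Delta>"
    by (simp add: \<xi>_def closed x_in zero)
  have "op (basis_x \<alpha>) (basis_x \<beta>) = diamond \<xi> (basis_x \<alpha>) (basis_x \<beta>)"
    if \<alpha>: "\<alpha> \<in> \<Delta>" and \<beta>: "\<beta> \<in> \<Delta>" for \<alpha> \<beta>
  proof (rule poly_mapping_eqI)
    fix k
    define \<theta> where "\<theta> = k - \<alpha> - \<beta>"
    define q where "q a b = Poly_Mapping.lookup (op (basis_x a) (basis_x b)) (a + b + \<theta>)" for a b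
    \<comment> \<open>The subtracted term is the coefficient for \<xi> = 0. It accounts for the
      prescribed commutator, which makes \<phi> symmetric, and it solves the same functional
      equation, so \<phi> does too.\<close>
    define \<phi> where "\<phi> a b = q a b - (if \<theta> = 0 then b else 0)" for a b
    have lookup_bracket: "Poly_Mapping.lookup (op (basis_x a) (op (basis_x b) (basis_x c))
          - op (op (basis_x b) (basis_x c)) (basis_x a)) (a + b + c + \<theta>)
        = (b + c + \<theta> - a) * q b c"
      if "a \<in> \<Delta>" "b \<in> \<Delta>" "c \<in> \<Delta>" for a b c
      using lookup_commutator[OF assms bilinear comm that(1) closed[OF x_in[OF that(2)] x_in[OF that(3)]],
          of "b + c + \<theta>"]
      by (simp add: q_def add.assoc)
    have sym: "\<phi> a b = \<phi> b a" if "a \<in> \<Delta>" "b \<in> \<Delta>" for a b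
      using arg_cong[OF comm[OF that], of "\<lambda>u. Poly_Mapping.lookup u (a + b + \<theta>)"]
      by (auto simp: \<phi>_def q_def lookup_minus lookup_smult lookup_basis_x
          add.commute algebra_simps)
    have eq: "(b - a) * \<phi> (a + b) c = (b + c + \<theta> - a) * \<phi> b c - (a + c + \<theta> - b) * \<phi> a c
        + (c - b) * \<phi> (b + c) a - (c - a) * \<phi> (a + c) b"
      if abc: "a \<in> \<Delta>" "b \<in> \<Delta>" "c \<in> \<Delta>" for a b c
    proof -
      \<comment> \<open>Coefficients of \<open>commutator_identity\<close> in degree
        \<open>a + b + c + \<theta>\<close>: the nested commutators come from
        \<open>lookup_bracket\<close>, the inner ones are multiples of basis elements by
        \<open>comm\<close>.\<close>
      have "(b - a) * q (a + b) c = (b + c + \<theta> - a) * q b c - (a + c + \<theta> - b) * q a c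
          + (c - b) * q (b + c) a - (c - a) * q (a + c) b"
        using arg_cong[OF commutator_identity[OF x_in[OF abc(1)] x_in[OF abc(2)] x_in[OF abc(3)]],
            of "\<lambda>u. Poly_Mapping.lookup u (a + b + c + \<theta>)"]
          lookup_bracket[OF abc] lookup_bracket[OF abc(2,1,3)]
        unfolding lookup_minus[of "_ + _"] lookup_add lookup_minus[of "_ - _" "_ - _"]
          comm[OF abc(1,2)] comm[OF abc(2,3)] comm[OF abc(1,3)]
        by (simp add: scale_left x_in abc add lookup_smult q_def ac_simps)
      then show ?thesis
        by (cases "\<theta> = 0") (simp_all add: \<phi>_def algebra_simps)
    qed
    \<comment> \<open>The subtracted term vanishes at second argument 0, so
      \<open>\<phi> 0 0\<close> is the coefficient of \<xi> at \<theta>.\<close>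
    have "\<phi> \<alpha> \<beta> = \<phi> 0 0"
      by (rule symmetric_cocycle_constant[OF assms sym eq \<alpha> \<beta>])
    moreover have "k = \<alpha> + \<beta> + \<theta>"
      by (simp add: \<theta>_def)
    ultimately show "Poly_Mapping.lookup (op (basis_x \<alpha>) (basis_x \<beta>)) k =
        Poly_Mapping.lookup (diamond \<xi> (basis_x \<alpha>) (basis_x \<beta>)) k"
      using lookup_mult_basis_x[of \<xi> "\<alpha> + \<beta>" \<theta>]
      by (auto simp: \<phi>_def q_def \<xi>_def diamond_basis lookup_add lookup_smult lookup_basis_x
          diff_eq_eq add.commute split: if_splits)
  qed
  \<comment> \<open>Bilinearity of \<open>diamond \<xi>\<close> comes from the converse direction,
    applied to \<open>diamond \<xi>\<close> itself.\<close>
  then have "op u v = diamond \<xi> u v"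
    if "u \<in> group_algebra \<Delta>" "v \<in> group_algebra \<Delta>" for u v
    using bilinear_operations_eqI[OF bilinear
        novikov_algebra.bilinear[OF novikov_algebra_diamond[OF assms \<xi> refl]] _ that] by blast
  with \<xi> show ?diamond by blast
qed

end
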